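(* For $n\ge 3$ and $m\ge 2$, $$sn(T(n,m))=\begin{cases}1 & \text{if } n \text{ is even},\\ \left\lfloor\frac{n+m}{2}\right\rfloor & \text{if } n \text{ is odd}.\end{cases}$$
   Context: Graphs are finite, undirected and simple. The tadpole graph $T(n,m)$ is obtained from a cycle $C_n$ on $n$ vertices and a path $P_m$ on $m$ vertices by identifying a vertex of $C_n$ with an end vertex of $P_m$ (so it has $n+m-1$ vertices). Let $G=(V,E)$ be a connected graph with chromatic number $\chi(G)=k\ge 2$. For $S\subset V$, a partial coloring on $G[S]$ is a proper coloring $\mathscr C_0$ of the induced subgraph $G[S]$ with colors from $\{1,\dots,k\}$ (not all colors need be used). It is a Sudoku coloring of $G$ if there is exactly one proper $k$-coloring $V\to\{1,\dots,k\}$ of $G$ whose restriction to $S$ is $\mathscr C_0$. The Sudoku number $sn(G)$ is the smallest $|S|$ such that $G[S]$ admits a Sudoku coloring of $G$. *)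

theory Defs
  imports "Graph_Theory.Graph_Theory" "HOL-Library.FuncSet"
begin

text \<open>
  A finite simple undirected graph is a \<^locale>\<open>pair_graph\<close>: each edge is the pair of arcs
  \<open>(u, v)\<close>, \<open>(v, u)\<close>. Colorings are extensional functions, i.e. undefined outside the vertex set,
  so that equality of colorings (hence uniqueness) is equality on the vertices.
\<close>

definition proper_coloring :: "('a, 'b) pre_digraph \<Rightarrow> nat \<Rightarrow> ('a \<Rightarrow> nat) \<Rightarrow> bool" where
  "proper_coloring G k c \<longleftrightarrow>
     c \<in> verts G \<rightarrow>\<^sub>E {1..k} \<and> (\<forall>(u, v) \<in> arcs_ends G. c u \<noteq> c v)"

definition chromatic_number :: "('a, 'b) pre_digraph \<Rightarrow> nat" where
  "chromatic_number G = (LEAST k. \<exists>c. proper_coloring G k c)"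

text \<open>The number of colors allowed on \<open>S\<close> is that of \<open>G\<close>, not the chromatic number of \<open>G \<restriction> S\<close>.\<close>

definition partial_coloring :: "('a, 'b) pre_digraph \<Rightarrow> 'a set \<Rightarrow> ('a \<Rightarrow> nat) \<Rightarrow> bool" where
  "partial_coloring G S c0 \<longleftrightarrow>
     S \<subseteq> verts G \<and> proper_coloring (G \<restriction> S) (chromatic_number G) c0"

definition sudoku_coloring :: "('a, 'b) pre_digraph \<Rightarrow> 'a set \<Rightarrow> ('a \<Rightarrow> nat) \<Rightarrow> bool" where
  "sudoku_coloring G S c0 \<longleftrightarrow> partial_coloring G S c0 \<and>
     (\<exists>!c. proper_coloring G (chromatic_number G) c \<and> restrict c S = c0)"

text \<open>Meaningful for connected finite simple graphs of chromatic number at least 2.\<close>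

definition sudoku_number :: "('a, 'b) pre_digraph \<Rightarrow> nat" where
  "sudoku_number G = (LEAST s. \<exists>S c0. sudoku_coloring G S c0 \<and> card S = s)"

definition cycle_graph :: "nat \<Rightarrow> nat pair_pre_digraph" where
  "cycle_graph n = \<lparr> pverts = {0..<n},
     parcs = {(u, v). u < n \<and> v < n \<and> (v = Suc u mod n \<or> u = Suc v mod n)} \<rparr>"

definition path_graph :: "nat \<Rightarrow> nat pair_pre_digraph" where
  "path_graph m = \<lparr> pverts = {0..<m},
     parcs = {(u, v). u < m \<and> v < m \<and> (v = Suc u \<or> u = Suc v)} \<rparr>"

text \<open>
  Shifting the path by \<open>n - 1\<close> identifies its end vertex \<open>0\<close> with the vertex \<open>n - 1\<close> of the cycle;
  the vertex set is \<open>{0..<n + m - 1}\<close>.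
\<close>

definition tadpole :: "nat \<Rightarrow> nat \<Rightarrow> nat pair_pre_digraph" where
  "tadpole n m = (let f = (\<lambda>j. j + (n - 1)) in
     \<lparr> pverts = pverts (cycle_graph n) \<union> f ` pverts (path_graph m),
       parcs = parcs (cycle_graph n) \<union> map_prod f f ` parcs (path_graph m) \<rparr>)"

lemma pverts_tadpole:
  assumes "n \<ge> 3" "m \<ge> 2"
  shows "pverts (tadpole n m) = {0..<n + m - 1}"
proof -
  have "(\<lambda>j. j + (n - 1)) ` {0..<m} = {n - 1..<m + (n - 1)}"
    using image_add_atLeastLessThan'[of "n - 1" 0 m] by simp
  then show ?thesis
    using assms by (auto simp: tadpole_def cycle_graph_def path_graph_def Let_def)
qed

lemma parcs_tadpole_iff:
  assumes "n \<ge> 3" "m \<ge> 2"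
  shows "(u, v) \<in> parcs (tadpole n m) \<longleftrightarrow>
    u < n \<and> v < n \<and> (v = Suc u mod n \<or> u = Suc v mod n) \<or>
    n - 1 \<le> u \<and> n - 1 \<le> v \<and> u < n + m - 1 \<and> v < n + m - 1 \<and> (v = Suc u \<or> u = Suc v)"
proof -
  have "(u, v) \<in> map_prod (\<lambda>j. j + (n - 1)) (\<lambda>j. j + (n - 1)) ` parcs (path_graph m) \<longleftrightarrow>
    n - 1 \<le> u \<and> n - 1 \<le> v \<and> u < n + m - 1 \<and> v < n + m - 1 \<and> (v = Suc u \<or> u = Suc v)"
    (is "?L \<longleftrightarrow> ?R")
  proof
    assume ?L
    then obtain i j where "i < m" "j < m" "j = Suc i \<or> i = Suc j"
      "u = i + (n - 1)" "v = j + (n - 1)"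
      by (auto simp: path_graph_def)
    then show ?R using assms by linarith
  next
    assume R: ?R
    have "(u - (n - 1), v - (n - 1)) \<in> parcs (path_graph m)"
      using R assms unfolding path_graph_def by auto
    then show ?L using R by (intro image_eqI[where x = "(u - (n - 1), v - (n - 1))"]) simp_all
  qed
  then show ?thesis by (simp add: tadpole_def cycle_graph_def Let_def)
qed

lemma pair_graph_tadpole:
  assumes "n \<ge> 3" "m \<ge> 2"
  shows "pair_graph (tadpole n m)"
proof -
  have *: "u \<in> pverts (tadpole n m)" "v \<in> pverts (tadpole n m)" "u \<noteq> v"
    "(v, u) \<in> parcs (tadpole n m)"
    if uv: "(u, v) \<in> parcs (tadpole n m)" for u v
  proof -
    show "u \<in> pverts (tadpole n m)" "v \<in> pverts (tadpole n m)"
      using uv[unfolded parcs_tadpole_iff[OF assms]] assms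
      unfolding pverts_tadpole[OF assms] atLeastLessThan_iff by linarith+
    show "u \<noteq> v"
      using uv[unfolded parcs_tadpole_iff[OF assms]] assms by (auto simp: mod_Suc split: if_splits)
    show "(v, u) \<in> parcs (tadpole n m)"
      using uv unfolding parcs_tadpole_iff[OF assms] by blast
  qed
  have fin: "finite (pverts (tadpole n m))"
    using pverts_tadpole[OF assms] by simp
  have "parcs (tadpole n m) \<subseteq> pverts (tadpole n m) \<times> pverts (tadpole n m)"
    by (rule subrelI) (simp add: *(1,2))
  then have fin': "finite (parcs (tadpole n m))"
    using fin by (meson finite_SigmaI finite_subset)
  show ?thesis
  proof unfold_locales
    show "fst e \<in> pverts (tadpole n m)" "snd e \<in> pverts (tadpole n m)" "fst e \<noteq> snd e"
      if "e \<in> parcs (tadpole n m)" for e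
      using that *(1-3)[of "fst e" "snd e"] by simp_all
    show "symmetric (with_proj (tadpole n m))"
      unfolding symmetric_def with_proj_simps by (rule symI) (rule *(4))
  qed (fact fin fin')+
qed

lemma Suc_arc_tadpole:
  assumes "n \<ge> 3" "m \<ge> 2" "Suc i < n + m - 1"
  shows "(i, Suc i) \<in> parcs (tadpole n m)"
proof (cases "Suc i < n")
  case True
  then show ?thesis unfolding parcs_tadpole_iff[OF assms(1,2)] by simp
next
  case False
  then show ?thesis using assms(3) unfolding parcs_tadpole_iff[OF assms(1,2)] by linarith
qed

lemma connected_tadpole:
  assumes "n \<ge> 3" "m \<ge> 2"
  shows "connected (tadpole n m)"
proof -
  interpret pair_graph "tadpole n m" by (rule pair_graph_tadpole[OF assms])
  have reach: "0 \<rightarrow>\<^sup>*\<^bsub>tadpole n m\<^esub> i" if "i < n + m - 1" for i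
    using that
  proof (induction i)
    case 0
    then show ?case using pverts_tadpole[OF assms] by (intro reachable_refl) simp
  next
    case (Suc i)
    then have "0 \<rightarrow>\<^sup>*\<^bsub>tadpole n m\<^esub> i" by simp
    moreover have "i \<rightarrow>\<^bsub>tadpole n m\<^esub> Suc i"
      using Suc_arc_tadpole[OF assms Suc.prems] by simp
    ultimately show ?case by (rule Digraph.wf_digraph.reachable_adj_trans[OF wf_digraph_axioms])
  qed
  have "strongly_connected (tadpole n m)"
  proof (rule strongly_connectedI)
    show "verts (tadpole n m) \<noteq> {}" using pverts_tadpole[OF assms] assms by auto
  next
    fix u v assume "u \<in> verts (tadpole n m)" "v \<in> verts (tadpole n m)"
    then have "0 \<rightarrow>\<^sup>*\<^bsub>tadpole n m\<^esub> u" "0 \<rightarrow>\<^sup>*\<^bsub>tadpole n m\<^esub> v"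
      using reach pverts_tadpole[OF assms] by auto
    then show "u \<rightarrow>\<^sup>*\<^bsub>tadpole n m\<^esub> v"
      using reachable_trans symmetric_reachable' by blast
  qed
  moreover have "parcs (mk_symmetric (tadpole n m)) = parcs (tadpole n m)"
    using adj_mk_symmetric_eq[OF pair_sym_arcs] by simp
  then have "mk_symmetric (tadpole n m) = tadpole n m"
    by (intro pair_pre_digraph.equality) simp_all
  ultimately show ?thesis by (simp add: connected_def)
qed

text \<open>The minima defining the chromatic number and the Sudoku number are attained.\<close>

lemma chromatic_number_attained:
  assumes "pair_graph G"
  shows "\<exists>c. proper_coloring G (chromatic_number G) c"
proof -
  interpret pair_graph G by fact
  obtain f where f: "bij_betw f (pverts G) {1..card (pverts G)}"
    using finite_same_card_bij[of "pverts G" "{1..card (pverts G)}"] pair_finite_verts by auto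
  have "proper_coloring G (card (pverts G)) (restrict f (pverts G))"
    unfolding proper_coloring_def
  proof (intro conjI)
    show "restrict f (pverts G) \<in> verts G \<rightarrow>\<^sub>E {1..card (pverts G)}"
      using f by (auto simp: bij_betw_def)
    show "\<forall>(u, v) \<in> arcs_ends G. restrict f (pverts G) u \<noteq> restrict f (pverts G) v"
    proof (intro ballI case_prodI2)
      fix e u v assume "e \<in> arcs_ends G" "e = (u, v)"
      then have "(u, v) \<in> parcs G" by simp
      then have "u \<in> pverts G" "v \<in> pverts G" "u \<noteq> v"
        using wellformed' pair_no_loops[of "(u, v)"] by auto
      then show "restrict f (pverts G) u \<noteq> restrict f (pverts G) v"
        using bij_betw_imp_inj_on[OF f] by (simp add: inj_on_eq_iff)
    qed
  qed
  then have "\<exists>k c. proper_coloring G k c" by blast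
  then show ?thesis unfolding chromatic_number_def by (rule LeastI_ex)
qed

lemma sudoku_number_attained:
  assumes "pair_graph G"
  shows "\<exists>S c0. sudoku_coloring G S c0 \<and> card S = sudoku_number G"
proof -
  interpret pair_graph G by fact
  obtain c where c: "proper_coloring G (chromatic_number G) c"
    using chromatic_number_attained[OF assms] by blast
  have restr: "restrict d (verts G) = d" if "proper_coloring G k d" for d k
    using that unfolding proper_coloring_def by (meson PiE_restrict)
  have "proper_coloring (G \<restriction> verts G) (chromatic_number G) c"
    using c by (auto simp: proper_coloring_def arcs_ends_conv)
  then have "sudoku_coloring G (verts G) c"
    using c restr by (auto simp: sudoku_coloring_def partial_coloring_def)
  then have "\<exists>s S c0. sudoku_coloring G S c0 \<and> card S = s" by blast
  then show ?thesis unfolding sudoku_number_def by (rule LeastI_ex)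
qed

end

theory Submission
  imports Defs
begin

text \<open>
  For the lower bound with \<open>n\<close> odd, let \<open>c\<close> be the unique extension of a Sudoku coloring on \<open>S\<close>.
  In the subgraph spanned by two color classes every component meets \<open>S\<close>, as otherwise exchanging
  the two colors on it would yield another extension. Hence that subgraph has at least as many edges
  as vertices outside \<open>S\<close>. Summing over the three pairs of colors, each vertex is counted twice and
  each edge once, so \<open>2 (|V| - |S|) \<le> |E| = |V|\<close>.

  For the upper bound, \<open>S\<close> takes about every second vertex, colored such that any vertex outside \<open>S\<close>
  has, possibly after one preliminary step, two neighbors of known different colors.
\<close>

section \<open>Proper colorings, and Sudoku colorings as unique extensions\<close>

lemma proper_coloring_iff:
  "proper_coloring (with_proj G) k c \<longleftrightarrow>
     c \<in> pverts G \<rightarrow>\<^sub>E {1..k} \<and> (\<forall>u v. (u, v) \<in> parcs G \<longrightarrow> c u \<noteq> c v)"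
  unfolding proper_coloring_def by auto

lemma proper_coloring_eqI:
  assumes "proper_coloring (with_proj G) k c" "proper_coloring (with_proj G) l d"
    and "\<And>v. v \<in> pverts G \<Longrightarrow> d v = c v"
  shows "d = c"
  by (rule extensionalityI[of _ "pverts G"])
    (use assms in \<open>auto simp: proper_coloring_iff PiE_iff\<close>)

lemma sudoku_coloringI:
  assumes "proper_coloring G (chromatic_number G) c" "S \<subseteq> verts G"
    and "\<And>d. proper_coloring G (chromatic_number G) d \<Longrightarrow> (\<And>v. v \<in> S \<Longrightarrow> d v = c v) \<Longrightarrow> d = c"
  shows "sudoku_coloring G S (restrict c S)"
proof -
  have "proper_coloring (G \<restriction> S) (chromatic_number G) (restrict c S)"
    using assms(1,2) unfolding proper_coloring_def
    by (auto simp: arcs_ends_def arc_to_ends_def)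
  moreover have "d = c" if "proper_coloring G (chromatic_number G) d" "restrict d S = restrict c S" for d
    using assms(3)[OF that(1)] that(2) by (metis restrict_apply')
  ultimately show ?thesis
    using assms(1,2) unfolding sudoku_coloring_def partial_coloring_def by blast
qed

lemma sudoku_coloringE:
  assumes "sudoku_coloring G S c0"
  obtains c where "S \<subseteq> verts G" "proper_coloring G (chromatic_number G) c"
    "\<And>d. proper_coloring G (chromatic_number G) d \<Longrightarrow> (\<And>v. v \<in> S \<Longrightarrow> d v = c v) \<Longrightarrow> d = c"
proof -
  from assms obtain c where S: "S \<subseteq> verts G"
    and c: "proper_coloring G (chromatic_number G) c" "restrict c S = c0"
    and uniq: "\<And>d. proper_coloring G (chromatic_number G) d \<Longrightarrow> restrict d S = c0 \<Longrightarrow> d = c"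
    unfolding sudoku_coloring_def partial_coloring_def by metis
  have "d = c" if "proper_coloring G (chromatic_number G) d" "\<And>v. v \<in> S \<Longrightarrow> d v = c v" for d
  proof (rule uniq[OF that(1)])
    show "restrict d S = c0" using that(2) c(2) by (metis restrict_ext)
  qed
  then show thesis using that S c by blast
qed

section \<open>Kempe exchanges and the counting bound\<close>

text \<open>\<open>closed\<close> makes \<open>W\<close> a union of components of the subgraph
  spanned by the colors \<open>a\<close> and \<open>b\<close>. Edges inside \<open>W\<close> have
  both ends exchanged, and an edge leaving \<open>W\<close> ends in a color other than these
  two.\<close>

lemma kempe_exchange:
  assumes "pair_graph G" "proper_coloring (with_proj G) k c" "a \<in> {1..k}" "b \<in> {1..k}"
    and W: "W \<subseteq> {v \<in> pverts G. c v = a \<or> c v = b}"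
    and closed: "\<And>u v. (u, v) \<in> parcs G \<Longrightarrow> u \<in> W \<Longrightarrow> c v = a \<or> c v = b \<Longrightarrow> v \<in> W"
  shows "proper_coloring (with_proj G) k
    (\<lambda>v. if v \<in> W then (if c v = a then b else a) else c v)" (is "proper_coloring _ _ ?d")
proof -
  interpret pair_graph G by fact
  have "?d \<in> pverts G \<rightarrow>\<^sub>E {1..k}"
    using assms(2-4) W unfolding proper_coloring_iff by (auto simp: PiE_iff extensional_def)
  moreover have "?d u \<noteq> ?d v" if "(u, v) \<in> parcs G" for u v
  proof -
    have "(v, u) \<in> parcs G" using that by (rule arcs_symmetric)
    moreover have "c u \<noteq> c v" using that assms(2) unfolding proper_coloring_iff by blast
    ultimately show ?thesis
      using that closed[of u v] closed[of v u] W by auto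
  qed
  ultimately show ?thesis unfolding proper_coloring_iff by blast
qed

text \<open>\<open>c\<close> is the completed coloring and \<open>S\<close> the set of clues. The
  number \<open>k\<close> of colors stays a parameter; it becomes 2 or 3 for tadpoles.\<close>

locale uniquely_extendable = pair_graph G for G :: "'a pair_pre_digraph" +
  fixes k :: nat and c :: "'a \<Rightarrow> nat" and S :: "'a set"
  assumes proper: "proper_coloring (with_proj G) k c"
    and unique: "\<And>d. proper_coloring (with_proj G) k d \<Longrightarrow> (\<And>v. v \<in> S \<Longrightarrow> d v = c v) \<Longrightarrow> d = c"
begin

text \<open>Without such an edge, \<open>V - X\<close> would be closed under bicolored adjacency and
  free of clues, so exchanging the two colors on it would give a second extension of the
  clues.\<close>

lemma bicolored_boundary:
  assumes "a \<in> {1..k}" "b \<in> {1..k}" "a \<noteq> b"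
    and V: "V = {v \<in> pverts G. c v = a \<or> c v = b}" and "V \<inter> S \<subseteq> X" "X \<subset> V"
  shows "\<exists>x\<in>X. \<exists>y\<in>V - X. (x, y) \<in> parcs G"
proof (rule ccontr)
  assume no: "\<not> ?thesis"
  define d where "d v = (if v \<in> V - X then (if c v = a then b else a) else c v)" for v
  have "proper_coloring (with_proj G) k (\<lambda>v. if v \<in> V - X then (if c v = a then b else a) else c v)"
  proof (rule kempe_exchange[OF pair_graph_axioms proper assms(1,2)])
    show "V - X \<subseteq> {v \<in> pverts G. c v = a \<or> c v = b}" using V by auto
  next
    fix u v assume uv: "(u, v) \<in> parcs G" "u \<in> V - X" "c v = a \<or> c v = b"
    then have "(v, u) \<in> parcs G" by (auto intro: arcs_symmetric)
    then have "v \<notin> X" using no uv by blast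
    moreover have "v \<in> pverts G" using wellformed'[OF uv(1)] by simp
    ultimately show "v \<in> V - X" using V uv by simp
  qed
  then have "proper_coloring (with_proj G) k d" unfolding d_def .
  then have "d = c"
    by (rule unique) (use assms(5) in \<open>auto simp: d_def\<close>)
  \<comment> \<open>The exchange really changes the color of \<open>w\<close>, because
    \<open>a\<close> and \<open>b\<close> differ.\<close>
  moreover obtain w where "w \<in> V - X" using assms(6) by blast
  ultimately show False
    using V assms(3) unfolding d_def fun_eq_iff by (metis (no_types, lifting) DiffD1 mem_Collect_eq)
qed

text \<open>Grow a set from \<open>V \<inter> S\<close> along boundary edges: each absorbed vertex
  brings a new bicolored edge. Taking only arcs directed from color \<open>a\<close> to color
  \<open>b\<close> counts every such edge once.\<close>

lemma bicolored_count:
  assumes "a \<in> {1..k}" "b \<in> {1..k}" "a \<noteq> b"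
  shows "card {v \<in> pverts G - S. c v = a} + card {v \<in> pverts G - S. c v = b}
    \<le> card {(u, v) \<in> parcs G. c u = a \<and> c v = b}"
proof -
  define V where "V = {v \<in> pverts G. c v = a \<or> c v = b}"
  define A where "A X = {(u, v) \<in> parcs G. c u = a \<and> c v = b \<and> u \<in> X \<and> v \<in> X}" for X
  have finV: "finite V" and finA: "finite (A X)" for X
    unfolding V_def A_def
    by (simp, rule finite_subset[OF _ pair_finite_arcs]) auto
  \<comment> \<open>Here \<open>j\<close> is the number of vertices outside \<open>S\<close>
    absorbed so far, and \<open>A X\<close> the set of edges collected inside
    \<open>X\<close>.\<close>
  have "\<exists>X. V \<inter> S \<subseteq> X \<and> X \<subseteq> V \<and> card (X - S) = j \<and> j \<le> card (A X)" if "j \<le> card (V - S)" for j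
    using that
  proof (induction j)
    case 0
    have "V \<inter> S - S = {}" by blast
    then have "card (V \<inter> S - S) = 0" by (simp only: card.empty)
    then show ?case by (intro exI[of _ "V \<inter> S"]) auto
  next
    case (Suc j)
    then obtain X where X: "V \<inter> S \<subseteq> X" "X \<subseteq> V" "card (X - S) = j" "j \<le> card (A X)" by auto
    then have "X \<noteq> V" using Suc.prems by auto
    with X obtain x y where xy: "x \<in> X" "y \<in> V - X" "(x, y) \<in> parcs G"
      using bicolored_boundary[OF assms V_def] by blast
    have finX: "finite X" using X finV finite_subset by blast
    have yx: "(y, x) \<in> parcs G" using xy(3) by (rule arcs_symmetric)
    have "c x \<noteq> c y" using proper xy(3) unfolding proper_coloring_iff by blast
    \<comment> \<open>One of the two arcs between \<open>x\<close> and \<open>y\<close> runs from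
      color \<open>a\<close> to color \<open>b\<close>; it is new because \<open>y\<close> is not in
      \<open>X\<close>.\<close>
    then have "\<exists>e \<in> A (insert y X). e \<notin> A X"
      using xy yx X(2) unfolding A_def V_def by blast
    moreover have "A X \<subseteq> A (insert y X)" unfolding A_def by blast
    ultimately have "card (A X) < card (A (insert y X))"
      using finA by (intro psubset_card_mono) auto
    moreover have "insert y X - S = insert y (X - S)" using xy X(1) by blast
    then have "card (insert y X - S) = Suc j" using xy finX X(3) by simp
    ultimately show ?case using X xy by (intro exI[of _ "insert y X"]) auto
  qed
  then obtain X where X: "X \<subseteq> V" "card (V - S) \<le> card (A X)" by blast
  have "{v \<in> pverts G - S. c v = a} \<union> {v \<in> pverts G - S. c v = b} = V - S"
    unfolding V_def by blast
  moreover have "{v \<in> pverts G - S. c v = a} \<inter> {v \<in> pverts G - S. c v = b} = {}"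
    using assms(3) by blast
  ultimately have "card {v \<in> pverts G - S. c v = a} + card {v \<in> pverts G - S. c v = b} = card (V - S)"
    using card_Un_disjoint[of "{v \<in> pverts G - S. c v = a}" "{v \<in> pverts G - S. c v = b}"] by simp
  also have "\<dots> \<le> card (A X)" by fact
  also have "\<dots> \<le> card {(u, v) \<in> parcs G. c u = a \<and> c v = b}"
    by (intro card_mono finite_subset[OF _ pair_finite_arcs]) (auto simp: A_def)
  finally show ?thesis .
qed

text \<open>Sum the two-color bound over ordered pairs of distinct colors. A vertex outside
  \<open>S\<close> is counted \<open>k - 1\<close> times through each coordinate, while an arc
  belongs to only one pair, that of its end colors.\<close>

lemma card_uncolored_le: "2 * (k - 1) * card (pverts G - S) \<le> card (parcs G)"
proof -
  define U where "U a = {v \<in> pverts G - S. c v = a}" for a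
  define A where "A p = {(u, v) \<in> parcs G. c u = fst p \<and> c v = snd p}" for p
  define P where "P = (SIGMA a:{1..k}. {1..k} - {a})"
  have finA: "finite (A p)" for p
    unfolding A_def by (rule finite_subset[OF _ pair_finite_arcs]) auto
  have finU: "finite (U a)" for a unfolding U_def by simp
  have col: "c v \<in> {1..k}" if "v \<in> pverts G" for v
    using proper that unfolding proper_coloring_iff by blast
  have "pverts G - S = (\<Union>a\<in>{1..k}. U a)" using col unfolding U_def by blast
  also have "card \<dots> = (\<Sum>a\<in>{1..k}. card (U a))"
    using finU by (intro card_UN_disjoint) (auto simp: U_def)
  finally have cU: "card (pverts G - S) = (\<Sum>a\<in>{1..k}. card (U a))" .
  have 1: "(\<Sum>a\<in>{1..k}. \<Sum>b\<in>{1..k}-{a}. card (U a)) = (k - 1) * card (pverts G - S)"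
    by (simp add: cU sum_distrib_left)
  \<comment> \<open>Exchanging the order of summation reduces the second coordinate to the
    first.\<close>
  have "(\<Sum>a\<in>{1..k}. \<Sum>b\<in>{1..k}-{a}. card (U b)) = (\<Sum>a\<in>{1..k}. \<Sum>b\<in>{b\<in>{1..k}. a \<noteq> b}. card (U b))"
    by (intro sum.cong) auto
  also have "\<dots> = (\<Sum>b\<in>{1..k}. \<Sum>a\<in>{a\<in>{1..k}. a \<noteq> b}. card (U b))"
    by (rule sum.swap_restrict) auto
  also have "\<dots> = (\<Sum>b\<in>{1..k}. \<Sum>a\<in>{1..k}-{b}. card (U b))"
    by (intro sum.cong) auto
  finally have 2: "(\<Sum>a\<in>{1..k}. \<Sum>b\<in>{1..k}-{a}. card (U b)) = (k - 1) * card (pverts G - S)"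
    using 1 by simp
  have "2 * (k - 1) * card (pverts G - S) = (\<Sum>a\<in>{1..k}. \<Sum>b\<in>{1..k}-{a}. card (U a) + card (U b))"
    using 1 2 by (simp add: sum.distrib)
  also have "\<dots> \<le> (\<Sum>a\<in>{1..k}. \<Sum>b\<in>{1..k}-{a}. card (A (a, b)))"
    by (intro sum_mono) (use bicolored_count in \<open>auto simp: U_def A_def\<close>)
  also have "\<dots> = (\<Sum>p\<in>P. card (A p))"
    unfolding P_def by (subst sum.Sigma) (auto simp: case_prod_beta)
  also have "\<dots> = card (\<Union>p\<in>P. A p)"
    using finA by (intro card_UN_disjoint[symmetric]) (auto simp: A_def P_def)
  also have "\<dots> \<le> card (parcs G)"
    by (intro card_mono pair_finite_arcs) (auto simp: A_def)
  finally show ?thesis .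
qed

text \<open>With no clues, the empty set would need a boundary edge to the nonempty class of
  \<open>c v\<close> and a second color.\<close>

lemma colored_nonempty:
  assumes "k \<ge> 2" "v \<in> pverts G" shows "S \<noteq> {}"
proof
  assume "S = {}"
  have "c v \<in> {1..k}" using proper assms(2) unfolding proper_coloring_iff by blast
  moreover obtain b where "b \<in> {1..k}" "c v \<noteq> b"
    using assms(1) that[of 1] that[of 2] by force
  ultimately show False
    using bicolored_boundary[of "c v" b _ "{}", OF _ _ _ refl] assms(2) \<open>S = {}\<close> by blast
qed

end

lemma sudoku_coloring_uniquely_extendable:
  assumes "pair_graph G" "sudoku_coloring (with_proj G) S c0"
  obtains c where "S \<subseteq> pverts G" "uniquely_extendable G (chromatic_number (with_proj G)) c S"
proof -
  interpret pair_graph G by fact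
  show thesis
  proof (rule sudoku_coloringE[OF assms(2)])
    fix c
    assume "S \<subseteq> verts (with_proj G)"
      and c: "proper_coloring (with_proj G) (chromatic_number (with_proj G)) c"
        "\<And>d. proper_coloring (with_proj G) (chromatic_number (with_proj G)) d \<Longrightarrow>
          (\<And>v. v \<in> S \<Longrightarrow> d v = c v) \<Longrightarrow> d = c"
    moreover have "uniquely_extendable G (chromatic_number (with_proj G)) c S"
      by unfold_locales (fact c)+
    ultimately show thesis using that by simp
  qed
qed

section \<open>Criteria for the chromatic number and the Sudoku number\<close>

text \<open>Excluding \<open>k - 1\<close> colors suffices, since a coloring with fewer colors is
  also one with \<open>k - 1\<close>.\<close>

lemma chromatic_numberI:
  assumes "proper_coloring G k c" "\<And>d. \<not> proper_coloring G (k - 1) d"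
  shows "chromatic_number G = k"
  unfolding chromatic_number_def
proof (rule Least_equality)
  show "\<exists>c. proper_coloring G k c" using assms(1) by blast
next
  fix l assume "\<exists>d. proper_coloring G l d"
  then obtain d where d: "proper_coloring G l d" by blast
  have "proper_coloring G (k - 1) d" if "l \<le> k - 1"
    using d that PiE_mono[of "verts G" "\<lambda>_. {1..l}" "\<lambda>_. {1..k - 1}"]
    unfolding proper_coloring_def by auto
  then show "k \<le> l" using assms(2) by fastforce
qed

lemma sudoku_number_eqI:
  assumes "pair_graph G" "sudoku_coloring (with_proj G) S c0" "card S \<le> s"
    and "\<And>T c. T \<subseteq> pverts G \<Longrightarrow>
      uniquely_extendable G (chromatic_number (with_proj G)) c T \<Longrightarrow> s \<le> card T"
  shows "sudoku_number (with_proj G) = s"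
proof (rule antisym)
  have "sudoku_number (with_proj G) \<le> card S"
    unfolding sudoku_number_def using assms(2) by (intro Least_le) blast
  then show "sudoku_number (with_proj G) \<le> s" using assms(3) by simp
  obtain T t0 where "sudoku_coloring (with_proj G) T t0" "card T = sudoku_number (with_proj G)"
    using sudoku_number_attained[OF assms(1)] by blast
  then show "s \<le> sudoku_number (with_proj G)"
    using assms(4) sudoku_coloring_uniquely_extendable[OF assms(1)] by metis
qed

section \<open>Structure of the tadpole and its 2-colorings\<close>

context
  fixes n m :: nat
  assumes n: "n \<ge> 3" and m: "m \<ge> 2"
begin

text \<open>The whole tadpole is the path 0, 1, ..., \<open>n + m - 2\<close> together with the
  single edge from 0 to \<open>n - 1\<close> that closes the cycle.\<close>

lemma parcs_tadpole:
  "parcs (tadpole n m) = (\<lambda>i. (i, Suc i)) ` {..<n + m - 2} \<union> (\<lambda>i. (Suc i, i)) ` {..<n + m - 2}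
     \<union> {(0, n - 1), (n - 1, 0)}" (is "_ = ?R")
proof (rule set_eqI, clarify)
  fix u v
  have R: "(u, v) \<in> ?R \<longleftrightarrow> v = Suc u \<and> v < n + m - 1 \<or> u = Suc v \<and> u < n + m - 1
    \<or> u = 0 \<and> v = n - 1 \<or> u = n - 1 \<and> v = 0"
    using n m unfolding Un_iff image_iff by auto
  have "Suc i mod n = (if Suc i = n then 0 else Suc i)" if "i < n" for i
    using that by simp
  then have cyc: "u < n \<and> v < n \<and> (v = Suc u mod n \<or> u = Suc v mod n) \<longleftrightarrow>
    u < n \<and> v < n \<and> (v = Suc u \<or> u = Suc v \<or> u = 0 \<and> v = n - 1 \<or> u = n - 1 \<and> v = 0)"
    using n by (cases "u < n \<and> v < n") auto
  consider "v = Suc u" | "u = Suc v" | "v \<noteq> Suc u" "u \<noteq> Suc v" by blast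
  then show "(u, v) \<in> parcs (tadpole n m) \<longleftrightarrow> (u, v) \<in> ?R"
    unfolding parcs_tadpole_iff[OF n m] R cyc by cases (use n m in auto)
qed

lemma card_parcs_tadpole_le: "card (parcs (tadpole n m)) \<le> 2 * (n + m - 1)"
proof -
  have "card (parcs (tadpole n m)) \<le> card ((\<lambda>i. (i, Suc i)) ` {..<n + m - 2})
    + card ((\<lambda>i. (Suc i, i)) ` {..<n + m - 2}) + card {(0, n - 1), (n - 1, 0)}"
    unfolding parcs_tadpole
    by (rule order.trans[OF card_Un_le add_right_mono[OF card_Un_le]])
  also have "\<dots> \<le> (n + m - 2) + (n + m - 2) + 2"
    by (intro add_mono) (use card_image_le[of "{..<n + m - 2}"] in \<open>auto simp: card_insert_if\<close>)
  finally show ?thesis using n by simp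
qed

lemma proper_coloring_tadpole_iff:
  "proper_coloring (with_proj (tadpole n m)) k c \<longleftrightarrow> c \<in> {0..<n + m - 1} \<rightarrow>\<^sub>E {1..k} \<and>
    (\<forall>i. Suc i < n + m - 1 \<longrightarrow> c i \<noteq> c (Suc i)) \<and> c 0 \<noteq> c (n - 1)"
proof -
  have "(\<forall>u v. (u, v) \<in> parcs (tadpole n m) \<longrightarrow> c u \<noteq> c v) \<longleftrightarrow>
    (\<forall>i. Suc i < n + m - 1 \<longrightarrow> c i \<noteq> c (Suc i)) \<and> c 0 \<noteq> c (n - 1)"
    unfolding parcs_tadpole by (auto simp: less_diff_conv)
  then show ?thesis unfolding proper_coloring_iff pverts_tadpole[OF n m] by auto
qed

text \<open>Two colors must alternate along the spanning path; \<open>3 - c 0\<close> is the other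
  color in {1, 2}.\<close>

lemma two_coloring_tadpole:
  assumes "proper_coloring (with_proj (tadpole n m)) 2 c" "i < n + m - 1"
  shows "c i = (if even i then c 0 else 3 - c 0)"
  using assms(2)
proof (induction i)
  case (Suc i)
  have "c j \<in> {1..2}" if "j < n + m - 1" for j
    using assms(1) that unfolding proper_coloring_tadpole_iff by auto
  from this[of 0] this[of i] this[of "Suc i"]
  have "c 0 \<in> {1..2}" "c i \<in> {1..2}" "c (Suc i) \<in> {1..2}" using Suc.prems by auto
  moreover have "c i \<noteq> c (Suc i)"
    using assms(1) Suc.prems unfolding proper_coloring_tadpole_iff by blast
  ultimately show ?case using Suc by (auto split: if_splits)
qed simp

section \<open>Tadpoles with an even cycle\<close>

text \<open>Two colors suffice, so the color of vertex 0 fixes all others; no coloring is determined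
  by an empty set of clues.\<close>

lemma sudoku_number_tadpole_even:
  assumes "even n"
  shows "sudoku_number (with_proj (tadpole n m)) = 1"
proof -
  let ?G = "tadpole n m"
  define c where "c = (\<lambda>i\<in>{0..<n + m - 1}. 1 + i mod 2)"
  have c: "proper_coloring (with_proj ?G) 2 c"
    unfolding proper_coloring_tadpole_iff using n m assms
    by (auto simp: c_def mod_Suc mod_2_eq_odd)
  have chi: "chromatic_number (with_proj ?G) = 2"
  proof (rule chromatic_numberI[OF c])
    fix d :: "nat \<Rightarrow> nat"
    have "d 0 \<noteq> d 1 \<and> d 0 \<in> {1..1} \<and> d 1 \<in> {1..1}" if "proper_coloring (with_proj ?G) 1 d"
      using that n m unfolding proper_coloring_tadpole_iff by (auto dest: PiE_mem)
    then show "\<not> proper_coloring (with_proj ?G) (2 - 1) d" by fastforce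
  qed
  have "sudoku_coloring (with_proj ?G) {0} (restrict c {0})"
  proof (rule sudoku_coloringI, unfold chi)
    fix d assume d: "proper_coloring (with_proj ?G) 2 d" "\<And>v. v \<in> {0} \<Longrightarrow> d v = c v"
    show "d = c"
    proof (rule proper_coloring_eqI[OF c d(1)])
      fix v assume "v \<in> pverts ?G"
      then have "v < n + m - 1" by (simp add: pverts_tadpole[OF n m])
      then show "d v = c v"
        using d(2)[of 0] two_coloring_tadpole[OF d(1), of v] two_coloring_tadpole[OF c, of v]
        by simp
    qed
  qed (use c n m in \<open>auto simp: pverts_tadpole[OF n m]\<close>)
  then show ?thesis
  proof (rule sudoku_number_eqI[OF pair_graph_tadpole[OF n m]])
    fix T d assume T: "T \<subseteq> pverts ?G" and "uniquely_extendable ?G (chromatic_number (with_proj ?G)) d T"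
    then interpret uniquely_extendable ?G 2 d T by (simp add: chi)
    have "T \<noteq> {}" by (rule colored_nonempty[of 0]) (use n in \<open>auto simp: pverts_tadpole[OF n m]\<close>)
    moreover have "finite T" using T finite_subset by (auto simp: pverts_tadpole[OF n m])
    ultimately show "1 \<le> card T" by (simp add: Suc_le_eq card_gt_0_iff)
  qed simp
qed

section \<open>Tadpoles with an odd cycle\<close>

text \<open>
  From vertex 2 on, the colors 2 and 3 alternate on every second vertex, with color 1 in between.
  If \<open>m\<close> is even, the parity of the vertices with color 1 changes at the end of the cycle, so that
  \<open>n\<close> and the end \<open>n + m - 2\<close> of the tail are among the vertices of color 2 or 3.
\<close>

definition tadpole_coloring :: "nat \<Rightarrow> nat" where
  "tadpole_coloring = (\<lambda>i\<in>{0..<n + m - 1}.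
     if i = 0 then 1 else if i = 1 then 2
     else if i < n \<or> odd m then (if even i then 2 + i div 2 mod 2 else 1)
     else (if even i then 1 else 3 - i div 2 mod 2))"

text \<open>For even \<open>m\<close> the clues jump from \<open>n - 3\<close> to \<open>n\<close>.
  Of the two vertices skipped, \<open>n - 1\<close> is recovered first, from its neighbors 0 and
  \<open>n\<close>.\<close>

definition tadpole_clues :: "nat set" where
  "tadpole_clues = (if odd m then {i. i < n + m - 1 \<and> even i}
     else {i. i < n - 1 \<and> even i} \<union> {i. n \<le> i \<and> i < n + m - 1 \<and> odd i})"

text \<open>\<open>f\<close> lists the clues in increasing order, with inverse
  \<open>i div 2\<close>; for even \<open>m\<close> the entries from index
  \<open>(n - 1) div 2\<close> on are odd.\<close>

lemma card_tadpole_clues: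
  assumes "odd n" shows "card tadpole_clues \<le> (n + m) div 2"
proof -
  define f where "f j = (if odd m \<or> 2 * j < n - 1 then 2 * j else 2 * j + 1)" for j
  have "tadpole_clues \<subseteq> f ` {..<(n + m) div 2}"
  proof
    fix i assume i: "i \<in> tadpole_clues"
    have "f (i div 2) = i" "i div 2 < (n + m) div 2"
      using i assms unfolding tadpole_clues_def f_def by (auto split: if_splits elim!: evenE oddE)
    then show "i \<in> f ` {..<(n + m) div 2}" by (metis imageI lessThan_iff)
  qed
  then have "card tadpole_clues \<le> card (f ` {..<(n + m) div 2})" by (intro card_mono) auto
  also have "\<dots> \<le> (n + m) div 2" using card_image_le[of "{..<(n + m) div 2}" f] by simp
  finally show ?thesis .
qed

lemma proper_tadpole_coloring:
  assumes "odd n" shows "proper_coloring (with_proj (tadpole n m)) 3 tadpole_coloring"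
  unfolding proper_coloring_tadpole_iff
proof (intro conjI allI impI)
  show "tadpole_coloring \<in> {0..<n + m - 1} \<rightarrow>\<^sub>E {1..3}"
    unfolding tadpole_coloring_def by (auto simp: PiE_iff)
  \<comment> \<open>Vertex 0 has color 1, whereas \<open>n - 1\<close> is even and positive, hence
    of color 2 or 3.\<close>
  show "tadpole_coloring 0 \<noteq> tadpole_coloring (n - 1)"
    using n m assms by (auto simp: tadpole_coloring_def)
  show "tadpole_coloring i \<noteq> tadpole_coloring (Suc i)" if "Suc i < n + m - 1" for i
  \<comment> \<open>This is where the parity pattern changes for even \<open>m\<close>: the colors
    are then \<open>2 + b\<close> and \<open>3 - b\<close> for the same bit \<open>b\<close>, hence
    different.\<close>
  proof (cases "Suc i = n")
    case True
    then have "i < n" "\<not> Suc i < n" "i \<noteq> 0" "i \<noteq> 1" "even i" using n assms by auto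
    then have "tadpole_coloring i = 2 + i div 2 mod 2"
      using that by (simp add: tadpole_coloring_def)
    moreover have "tadpole_coloring (Suc i) = (if odd m then 1 else 3 - i div 2 mod 2)"
      using that \<open>even i\<close> \<open>i \<noteq> 0\<close> \<open>\<not> Suc i < n\<close>
      by (simp add: tadpole_coloring_def)
    moreover have "i div 2 mod 2 = 0 \<or> i div 2 mod 2 = 1" by linarith
    ultimately show ?thesis by auto
  next
    case False
    then consider "Suc i < n \<or> odd m" | "n \<le> i" "even m" by linarith
    then show ?thesis
    proof cases
      case 1
      then show ?thesis using that by (auto simp: tadpole_coloring_def)
    next
      case 2
      then show ?thesis using that n by (auto simp: tadpole_coloring_def)
    qed
  qed
qed

text \<open>Once \<open>n - 1\<close> is known, any vertex still missing lies on the path between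
  two known vertices of different colors, and only the third color remains.\<close>

lemma tadpole_coloring_unique:
  assumes "odd n" and d: "proper_coloring (with_proj (tadpole n m)) 3 d"
    and clues: "\<And>v. v \<in> tadpole_clues \<Longrightarrow> d v = tadpole_coloring v"
  shows "d = tadpole_coloring"
proof (rule proper_coloring_eqI[OF proper_tadpole_coloring[OF assms(1)] d])
  have third: "x = y" if "x \<in> {1..3}" "y \<in> {1..3}" "p \<noteq> q" "x \<noteq> p" "x \<noteq> q" "y \<noteq> p" "y \<noteq> q"
    "p \<in> {1..3}" "q \<in> {1..3}" for x y p q :: nat
    using that by auto
  note c = proper_tadpole_coloring[OF assms(1)]
  have range: "e i \<in> {1..3}" if "proper_coloring (with_proj (tadpole n m)) 3 e" "i < n + m - 1" for e i
    using that unfolding proper_coloring_tadpole_iff by auto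
  have between: "d (Suc i) = tadpole_coloring (Suc i)"
    if "Suc (Suc i) < n + m - 1" "d i = tadpole_coloring i"
      "d (Suc (Suc i)) = tadpole_coloring (Suc (Suc i))"
      "tadpole_coloring i \<noteq> tadpole_coloring (Suc (Suc i))" for i
  proof -
    have "e i \<noteq> e (Suc i)" "e (Suc i) \<noteq> e (Suc (Suc i))"
      if "proper_coloring (with_proj (tadpole n m)) 3 e" for e
      using that \<open>Suc (Suc i) < n + m - 1\<close> unfolding proper_coloring_tadpole_iff by auto
    from this[OF c] this[OF d] show ?thesis
      by (intro third[OF _ _ that(4)]) (use that range[OF c] range[OF d] in auto)
  qed
  \<comment> \<open>The preliminary step: for odd \<open>m\<close> the vertex \<open>n - 1\<close>
    is a clue, otherwise its neighbors 0 and \<open>n\<close> are clues of different colors.\<close>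
  have last: "d (n - 1) = tadpole_coloring (n - 1)"
  proof (cases "odd m")
    case True
    then show ?thesis using n m assms(1) by (intro clues) (auto simp: tadpole_clues_def)
  next
    case False
    have clue: "d 0 = tadpole_coloring 0" "d n = tadpole_coloring n"
      using False n m assms(1) by (auto intro!: clues simp: tadpole_clues_def)
    have neq: "tadpole_coloring 0 \<noteq> tadpole_coloring n"
      using False n m assms(1) by (auto simp: tadpole_coloring_def)
    have "e (n - 1) \<noteq> e n" "e (n - 1) \<noteq> e 0"
      if "proper_coloring (with_proj (tadpole n m)) 3 e" for e
    proof -
      have "Suc (n - 1) = n" "Suc (n - 1) < n + m - 1" using n m by auto
      then show "e (n - 1) \<noteq> e n" "e (n - 1) \<noteq> e 0"
        using that unfolding proper_coloring_tadpole_iff by metis+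
    qed
    from this[OF c] this[OF d] show ?thesis
      by (intro third[OF _ _ neq]) (use clue n m range[OF c] range[OF d] in auto)
  qed
  fix v assume "v \<in> pverts (tadpole n m)"
  then have v: "v < n + m - 1" by (simp add: pverts_tadpole[OF n m])
  show "d v = tadpole_coloring v"
  proof (cases "v \<in> tadpole_clues \<or> v = n - 1")
    case True
    then show ?thesis using clues last by auto
  next
    case False
    then obtain i where i: "v = Suc i"
      using n m assms(1) by (cases v) (auto simp: tadpole_clues_def split: if_splits)
    have known: "i \<in> tadpole_clues \<or> i = n - 1"
      using False v n m assms(1) unfolding i by (auto simp: tadpole_clues_def split: if_splits)
    have known': "Suc (Suc i) \<in> tadpole_clues \<or> Suc (Suc i) = n - 1" "Suc (Suc i) < n + m - 1"
      using False v n m assms(1) unfolding i by (auto simp: tadpole_clues_def split: if_splits; presburger)+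
    have "tadpole_coloring i \<noteq> tadpole_coloring (Suc (Suc i))"
    proof -
      \<comment> \<open>Moving two vertices along flips the bit that selects between colors 2 and
        3.\<close>
      have step: "Suc (Suc i) div 2 mod 2 = 1 - i div 2 mod 2" by (simp add: mod_Suc)
      have bit: "i div 2 mod 2 = 0 \<or> i div 2 mod 2 = 1" by linarith
      consider "even i" "i < n - 2 \<or> odd m" | "odd i" "n \<le> i" "even m"
      proof (cases "odd m")
        case True
        then show thesis using that False v unfolding i by (auto simp: tadpole_clues_def)
      next
        case m: False
        have "Suc i < n - 1 \<and> odd (Suc i) \<or> n \<le> Suc i \<and> even (Suc i)"
          using False v m unfolding i by (auto simp: tadpole_clues_def)
        moreover have "n \<noteq> Suc i" if "even (Suc i)" using that assms(1) by blast
        ultimately have "even i \<and> i < n - 2 \<or> odd i \<and> n \<le> i" by auto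
        then show thesis using that m by blast
      qed
      then show ?thesis
      proof cases
        case 1
        \<comment> \<open>Vertex 0 is outside the alternation: its color 1 is compared with the
          color 3 of vertex 2.\<close>
        then show ?thesis
          using step bit n known'(2) by (cases "i = 0") (auto simp: tadpole_coloring_def)
      next
        case 2
        then show ?thesis
          using step bit n known'(2) by (auto simp: tadpole_coloring_def)
      qed
    qed
    moreover have "d i = tadpole_coloring i" "d (Suc (Suc i)) = tadpole_coloring (Suc (Suc i))"
      using known known'(1) clues[of i] clues[of "Suc (Suc i)"] last by metis+
    ultimately show ?thesis
      unfolding i by (intro between[OF known'(2)])
  qed
qed

lemma sudoku_number_tadpole_odd:
  assumes "odd n"
  shows "sudoku_number (with_proj (tadpole n m)) = (n + m) div 2"
proof -
  let ?G = "tadpole n m"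
  note c = proper_tadpole_coloring[OF assms]
  have chi: "chromatic_number (with_proj ?G) = 3"
  proof (rule chromatic_numberI[OF c])
    fix d
    show "\<not> proper_coloring (with_proj ?G) (3 - 1) d"
    proof
      assume "proper_coloring (with_proj ?G) (3 - 1) d"
      then have d: "proper_coloring (with_proj ?G) 2 d" by simp
      \<comment> \<open>As \<open>n - 1\<close> is even, alternation gives the same color to both
        ends of the closing edge.\<close>
      then have "d (n - 1) = d 0" using two_coloring_tadpole[OF d, of "n - 1"] n m assms by simp
      then show False using d unfolding proper_coloring_tadpole_iff by simp
    qed
  qed
  have "sudoku_coloring (with_proj ?G) tadpole_clues (restrict tadpole_coloring tadpole_clues)"
  proof (rule sudoku_coloringI, unfold chi)
    show "tadpole_clues \<subseteq> verts (with_proj ?G)"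
      using n m by (auto simp: pverts_tadpole[OF n m] tadpole_clues_def)
  qed (fact c, rule tadpole_coloring_unique[OF assms])
  then show ?thesis
  proof (rule sudoku_number_eqI[OF pair_graph_tadpole[OF n m] _ card_tadpole_clues[OF assms]])
    fix T d assume T: "T \<subseteq> pverts ?G" and "uniquely_extendable ?G (chromatic_number (with_proj ?G)) d T"
    then interpret uniquely_extendable ?G 3 d T by (simp add: chi)
    have "card (pverts ?G - T) = n + m - 1 - card T"
      using T by (subst card_Diff_subset) (auto simp: pverts_tadpole[OF n m] intro: finite_subset)
    \<comment> \<open>With \<open>N = n + m - 1\<close> vertices and at most \<open>2 * N\<close>
      arcs, three colors give \<open>2 * (N - card T) \<le> N\<close>; rounding \<open>N / 2\<close>
      up yields \<open>(n + m) div 2\<close>.\<close>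
    then show "(n + m) div 2 \<le> card T"
      using card_uncolored_le card_parcs_tadpole_le by simp
  qed
qed

end

theorem theorem3p8:
  fixes n m :: nat
  assumes "n \<ge> 3" and "m \<ge> 2"
  shows "sudoku_number (tadpole n m) = (if even n then 1 else (n + m) div 2)"
  using sudoku_number_tadpole_even[OF assms] sudoku_number_tadpole_odd[OF assms] by simp

end
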